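(* Let $X$ be an $\mathbb{H}$-normed space and let $\mathbf{Re}: X\to X$ be the projection $\mathbf{Re}(x)=\frac14\sum_{e\in B}e^*xe$. Then: (a) $\|\mathbf{Re}\|\le 1$; (b) $\mathcal{L}_{\mathbb{H}}(X;\mathbb{H})\cong \mathcal{L}_{\mathbb{R}}(X_{\mathrm{Re}};\mathbb{R})=X_{\mathrm{Re}}^*$ as $\mathbb{R}$-Banach spaces (i.e. isometrically, and $\mathbb{R}$-linearly), under the correspondence $\Psi: T\mapsto T|_{X_{\mathrm{Re}}}$.
   Context: $\mathbb{H}$ denotes the real quaternions with $\mathbb{R}$-basis $B=\{1,i,j,k\}$, conjugation $(a+bi+cj+dk)^*=a-bi-cj-dk$ and norm $\|a+bi+cj+dk\|=\sqrt{a^2+b^2+c^2+d^2}$; $\mathbb{R}$ is identified with its center. An $\mathbb{H}$-vector space is a unital $\mathbb{H}$-bimodule $X$ with $rx=xr$ for $r\in\mathbb{R}$. An $\mathbb{H}$-normed space is an $\mathbb{H}$-vector space with a norm making it a normed $\mathbb{H}$-bimodule ($\|\alpha x\beta\|\le\|\alpha\|\|x\|\|\beta\|$). Put $X_{\mathrm{Re}}=\{x\in X:\alpha x=x\alpha \text{ for all }\alpha\in\mathbb{H}\}$, a real normed space under the norm of $X$; the map $\mathbf{Re}$ is an $\mathbb{R}$-linear projection of $X$ onto $X_{\mathrm{Re}}$. $\mathcal{L}_{\mathbb{H}}(X;Y)$ is the space of bounded $\mathbb{H}$-bimodule maps between $\mathbb{H}$-normed spaces, $\mathcal{L}_{\mathbb{R}}(V;W)$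 the space of bounded $\mathbb{R}$-linear maps between real normed spaces, both with the operator norm. For $T\in\mathcal{L}_{\mathbb{H}}(X;\mathbb{H})$, $T$ maps $X_{\mathrm{Re}}$ into $\mathbb{H}_{\mathrm{Re}}=\mathbb{R}$. *)

theory Defs
  imports "HOL-Analysis.Analysis"
begin

section \<open>The real quaternions\<close>

datatype quat = Quat (qRe: real) (qI: real) (qJ: real) (qK: real)

lemma quat_eq_iff: "x = y \<longleftrightarrow> qRe x = qRe y \<and> qI x = qI y \<and> qJ x = qJ y \<and> qK x = qK y"
  by (cases x; cases y) auto

instantiation quat :: real_algebra_1
begin

definition "0 = Quat 0 0 0 0"
definition "1 = Quat 1 0 0 0"
definition "x + y = Quat (qRe x + qRe y) (qI x + qI y) (qJ x + qJ y) (qK x + qK y)"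
definition "- x = Quat (- qRe x) (- qI x) (- qJ x) (- qK x)"
definition "x - y = Quat (qRe x - qRe y) (qI x - qI y) (qJ x - qJ y) (qK x - qK y)"
definition "r *\<^sub>R x = Quat (r * qRe x) (r * qI x) (r * qJ x) (r * qK x)"
definition "x * y = Quat
  (qRe x * qRe y - qI x * qI y - qJ x * qJ y - qK x * qK y)
  (qRe x * qI y + qI x * qRe y + qJ x * qK y - qK x * qJ y)
  (qRe x * qJ y - qI x * qK y + qJ x * qRe y + qK x * qI y)
  (qRe x * qK y + qI x * qJ y - qJ x * qI y + qK x * qRe y)"

lemmas quat_arith_defs = zero_quat_def one_quat_def plus_quat_def uminus_quat_def
  minus_quat_def scaleR_quat_def times_quat_def

instance
  by standard (simp_all add: quat_arith_defs quat_eq_iff algebra_simps)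

end

lemma quat_sel_simps [simp]:
  "qRe 0 = 0" "qI 0 = 0" "qJ 0 = 0" "qK 0 = 0"
  "qRe 1 = 1" "qI 1 = 0" "qJ 1 = 0" "qK 1 = 0"
  "qRe (x + y) = qRe x + qRe y" "qI (x + y) = qI x + qI y"
  "qJ (x + y) = qJ x + qJ y" "qK (x + y) = qK x + qK y"
  "qRe (- x) = - qRe x" "qI (- x) = - qI x" "qJ (- x) = - qJ x" "qK (- x) = - qK x"
  "qRe (x - y) = qRe x - qRe y" "qI (x - y) = qI x - qI y"
  "qJ (x - y) = qJ x - qJ y" "qK (x - y) = qK x - qK y"
  "qRe (r *\<^sub>R x) = r * qRe x" "qI (r *\<^sub>R x) = r * qI x"
  "qJ (r *\<^sub>R x) = r * qJ x" "qK (r *\<^sub>R x) = r * qK x"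
  "qRe (x * y) = qRe x * qRe y - qI x * qI y - qJ x * qJ y - qK x * qK y"
  "qI (x * y) = qRe x * qI y + qI x * qRe y + qJ x * qK y - qK x * qJ y"
  "qJ (x * y) = qRe x * qJ y - qI x * qK y + qJ x * qRe y + qK x * qI y"
  "qK (x * y) = qRe x * qK y + qI x * qJ y - qJ x * qI y + qK x * qRe y"
  by (simp_all add: quat_arith_defs)

lemma quat_of_real_sel [simp]:
  "qRe (of_real r) = r" "qI (of_real r) = 0" "qJ (of_real r) = 0" "qK (of_real r) = 0"
  by (simp_all add: of_real_def)

definition quat_i :: quat where "quat_i = Quat 0 1 0 0"
definition quat_j :: quat where "quat_j = Quat 0 0 1 0"
definition quat_k :: quat where "quat_k = Quat 0 0 0 1"

lemma quat_unit_sel [simp]: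
  "qRe quat_i = 0" "qI quat_i = 1" "qJ quat_i = 0" "qK quat_i = 0"
  "qRe quat_j = 0" "qI quat_j = 0" "qJ quat_j = 1" "qK quat_j = 0"
  "qRe quat_k = 0" "qI quat_k = 0" "qJ quat_k = 0" "qK quat_k = 1"
  by (simp_all add: quat_i_def quat_j_def quat_k_def)

lemma quat_unit_mult:
  "quat_i * quat_i = -1" "quat_j * quat_j = -1" "quat_k * quat_k = -1"
  "quat_i * quat_j = quat_k" "quat_j * quat_k = quat_i" "quat_k * quat_i = quat_j"
  "quat_j * quat_i = - quat_k" "quat_k * quat_j = - quat_i" "quat_i * quat_k = - quat_j"
  by (simp_all add: quat_eq_iff)

definition qcnj :: "quat \<Rightarrow> quat" where
  "qcnj x = Quat (qRe x) (- qI x) (- qJ x) (- qK x)"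

lemma qcnj_sel [simp]:
  "qRe (qcnj x) = qRe x" "qI (qcnj x) = - qI x" "qJ (qcnj x) = - qJ x" "qK (qcnj x) = - qK x"
  by (simp_all add: qcnj_def)

instantiation quat :: real_inner
begin

definition norm_quat :: "quat \<Rightarrow> real" where
  "norm_quat x = sqrt ((qRe x)\<^sup>2 + (qI x)\<^sup>2 + (qJ x)\<^sup>2 + (qK x)\<^sup>2)"

definition inner_quat :: "quat \<Rightarrow> quat \<Rightarrow> real" where
  "inner_quat x y = qRe x * qRe y + qI x * qI y + qJ x * qJ y + qK x * qK y"

definition sgn_quat :: "quat \<Rightarrow> quat" where "sgn_quat x = x /\<^sub>R norm x"

definition dist_quat :: "quat \<Rightarrow> quat \<Rightarrow> real" where "dist_quat x y = norm (x - y)"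

definition [code del]:
  "(uniformity :: (quat \<times> quat) filter) = (INF e\<in>{0<..}. principal {(x, y). dist x y < e})"

definition [code del]:
  "open (U :: quat set) \<longleftrightarrow> (\<forall>x\<in>U. \<forall>\<^sub>F (x', y) in uniformity. x' = x \<longrightarrow> y \<in> U)"

instance
proof
  fix x y z :: quat and r :: real and S :: "quat set"
  show "dist x y = norm (x - y)" by (rule dist_quat_def)
  show "sgn x = x /\<^sub>R norm x" by (rule sgn_quat_def)
  show "(uniformity :: (quat \<times> quat) filter) = (INF e\<in>{0<..}. principal {(x, y). dist x y < e})"
    by (rule uniformity_quat_def)
  show "open S \<longleftrightarrow> (\<forall>x\<in>S. \<forall>\<^sub>F (x', y) in uniformity. x' = x \<longrightarrow> y \<in> S)"
    by (rule open_quat_def)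
  show "inner x y = inner y x" by (simp add: inner_quat_def algebra_simps)
  show "inner (x + y) z = inner x z + inner y z" by (simp add: inner_quat_def algebra_simps)
  show "inner (r *\<^sub>R x) y = r * inner x y" by (simp add: inner_quat_def algebra_simps)
  show "0 \<le> inner x x" by (simp add: inner_quat_def)
  show "inner x x = 0 \<longleftrightarrow> x = 0"
    by (simp add: inner_quat_def quat_eq_iff add_nonneg_eq_0_iff)
  show "norm x = sqrt (inner x x)"
    by (simp add: inner_quat_def norm_quat_def power2_eq_square)
qed

end

lemma norm_quat_mult: "norm (x * y) = norm x * norm (y::quat)"
  unfolding norm_quat_def real_sqrt_mult[symmetric]
  by (rule arg_cong[where f = sqrt]) (simp add: power2_eq_square algebra_simps)

instance quat :: real_normed_algebra_1
  by standard (simp_all add: norm_quat_mult, simp add: norm_quat_def)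

text \<open>The Euclidean structure supplies completeness; its basis is the standard basis \<open>{1, i, j, k}\<close>.\<close>

instantiation quat :: euclidean_space
begin

definition Basis_quat :: "quat set" where "Basis = {1, quat_i, quat_j, quat_k}"

lemma quat_units_distinct:
  "1 \<noteq> quat_i" "1 \<noteq> quat_j" "1 \<noteq> quat_k" "quat_i \<noteq> quat_j" "quat_i \<noteq> quat_k" "quat_j \<noteq> quat_k"
  by (simp_all add: quat_eq_iff)

instance
proof
  fix u v x :: quat
  show "(Basis :: quat set) \<noteq> {}" "finite (Basis :: quat set)"
    by (simp_all add: Basis_quat_def)
  show "inner u v = (if u = v then 1 else 0)" if "u \<in> Basis" "v \<in> Basis"
    using that quat_units_distinct quat_units_distinct[symmetric]
    unfolding Basis_quat_def inner_quat_def by (elim insertE emptyE) simp_all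
  show "(\<forall>u\<in>Basis. inner x u = 0) \<longleftrightarrow> x = 0"
    unfolding quat_eq_iff[of x 0] by (simp add: Basis_quat_def inner_quat_def)
qed

end


section \<open>Vector spaces and normed spaces over the quaternions\<close>

text \<open>
  The real scalar multiplication of the type is the one obtained by restricting either of the
  two quaternionic actions to the centre; the last two axioms hence contain the condition
  \<open>r x = x r\<close> for real \<open>r\<close>.
\<close>

class quat_vector = real_vector +
  fixes lscale :: "quat \<Rightarrow> 'a \<Rightarrow> 'a" (infixr \<open>\<cdot>\<^sub>l\<close> 75)
    and rscale :: "'a \<Rightarrow> quat \<Rightarrow> 'a" (infixl \<open>\<cdot>\<^sub>r\<close> 75)
  assumes lscale_add_right: "\<alpha> \<cdot>\<^sub>l (x + y) = \<alpha> \<cdot>\<^sub>l x + \<alpha> \<cdot>\<^sub>l y"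
    and lscale_add_left: "(\<alpha> + \<beta>) \<cdot>\<^sub>l x = \<alpha> \<cdot>\<^sub>l x + \<beta> \<cdot>\<^sub>l x"
    and lscale_lscale: "\<alpha> \<cdot>\<^sub>l (\<beta> \<cdot>\<^sub>l x) = (\<alpha> * \<beta>) \<cdot>\<^sub>l x"
    and lscale_one: "1 \<cdot>\<^sub>l x = x"
    and rscale_add_left: "(x + y) \<cdot>\<^sub>r \<alpha> = x \<cdot>\<^sub>r \<alpha> + y \<cdot>\<^sub>r \<alpha>"
    and rscale_add_right: "x \<cdot>\<^sub>r (\<alpha> + \<beta>) = x \<cdot>\<^sub>r \<alpha> + x \<cdot>\<^sub>r \<beta>"
    and rscale_rscale: "(x \<cdot>\<^sub>r \<alpha>) \<cdot>\<^sub>r \<beta> = x \<cdot>\<^sub>r (\<alpha> * \<beta>)"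
    and rscale_one: "x \<cdot>\<^sub>r 1 = x"
    and lscale_rscale: "(\<alpha> \<cdot>\<^sub>l x) \<cdot>\<^sub>r \<beta> = \<alpha> \<cdot>\<^sub>l (x \<cdot>\<^sub>r \<beta>)"
    and lscale_of_real: "of_real r \<cdot>\<^sub>l x = r *\<^sub>R x"
    and rscale_of_real: "x \<cdot>\<^sub>r of_real r = r *\<^sub>R x"

class quat_normed_vector = quat_vector + real_normed_vector +
  assumes norm_lscale_rscale: "norm ((\<alpha> \<cdot>\<^sub>l x) \<cdot>\<^sub>r \<beta>) \<le> norm \<alpha> * norm x * norm \<beta>"

instantiation quat :: quat_normed_vector
begin

definition lscale_quat :: "quat \<Rightarrow> quat \<Rightarrow> quat" where "lscale_quat \<alpha> x = \<alpha> * x"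
definition rscale_quat :: "quat \<Rightarrow> quat \<Rightarrow> quat" where "rscale_quat x \<alpha> = x * \<alpha>"

instance
  by standard
    (simp_all add: lscale_quat_def rscale_quat_def algebra_simps norm_quat_mult of_real_def)

end

lemma lscale_zero_right [simp]: "\<alpha> \<cdot>\<^sub>l (0::'a::quat_vector) = 0"
  using lscale_add_right[of \<alpha> "0::'a" 0] by simp

lemma rscale_zero_left [simp]: "(0::'a::quat_vector) \<cdot>\<^sub>r \<alpha> = 0"
  using rscale_add_left[of "0::'a" 0 \<alpha>] by simp

lemma lscale_minus_right [simp]: "\<alpha> \<cdot>\<^sub>l (- x) = - (\<alpha> \<cdot>\<^sub>l (x::'a::quat_vector))"
  using lscale_add_right[of \<alpha> x "- x"] by (simp add: add_eq_0_iff)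

lemma rscale_minus_left [simp]: "(- x) \<cdot>\<^sub>r \<alpha> = - ((x::'a::quat_vector) \<cdot>\<^sub>r \<alpha>)"
  using rscale_add_left[of x "- x" \<alpha>] by (simp add: add_eq_0_iff)

lemma lscale_diff_right: "\<alpha> \<cdot>\<^sub>l (x - y) = \<alpha> \<cdot>\<^sub>l x - \<alpha> \<cdot>\<^sub>l (y::'a::quat_vector)"
  using lscale_add_right[of \<alpha> x "- y"] by simp

lemma rscale_diff_left: "(x - y) \<cdot>\<^sub>r \<alpha> = x \<cdot>\<^sub>r \<alpha> - (y::'a::quat_vector) \<cdot>\<^sub>r \<alpha>"
  using rscale_add_left[of x "- y" \<alpha>] by simp

lemma lscale_scaleR: "\<alpha> \<cdot>\<^sub>l (r *\<^sub>R x) = r *\<^sub>R (\<alpha> \<cdot>\<^sub>l (x::'a::quat_vector))"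
proof -
  have "\<alpha> * of_real r = of_real r * \<alpha>" by (simp add: of_real_def)
  then show ?thesis by (metis lscale_lscale lscale_of_real)
qed

lemma rscale_scaleR: "(r *\<^sub>R x) \<cdot>\<^sub>r \<alpha> = r *\<^sub>R ((x::'a::quat_vector) \<cdot>\<^sub>r \<alpha>)"
  by (metis lscale_of_real lscale_rscale)

lemma norm_lscale_le: "norm (\<alpha> \<cdot>\<^sub>l x) \<le> norm (x::'a::quat_normed_vector) * norm \<alpha>"
  using norm_lscale_rscale[of \<alpha> x 1] by (simp add: rscale_one mult.commute)

lemma norm_rscale_le: "norm (x \<cdot>\<^sub>r \<alpha>) \<le> norm (x::'a::quat_normed_vector) * norm \<alpha>"
  using norm_lscale_rscale[of 1 x \<alpha>] by (simp add: lscale_one)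

lemma bounded_linear_lscale: "bounded_linear (\<lambda>x::'a::quat_normed_vector. \<alpha> \<cdot>\<^sub>l x)"
  by (rule bounded_linear_intro[where K = "norm \<alpha>"])
    (simp_all add: lscale_add_right lscale_scaleR norm_lscale_le)

lemma bounded_linear_rscale: "bounded_linear (\<lambda>x::'a::quat_normed_vector. x \<cdot>\<^sub>r \<alpha>)"
  by (rule bounded_linear_intro[where K = "norm \<alpha>"])
    (simp_all add: rscale_add_left rscale_scaleR norm_rscale_le)


section \<open>The real part of a quaternionic normed space\<close>

definition re_set :: "'a::quat_vector set" where
  "re_set = {x. \<forall>\<alpha>. \<alpha> \<cdot>\<^sub>l x = x \<cdot>\<^sub>r \<alpha>}"

definition re_proj :: "'a::quat_vector \<Rightarrow> 'a" where
  "re_proj x = (1/4) *\<^sub>R (\<Sum>e\<in>{1, quat_i, quat_j, quat_k}. (qcnj e \<cdot>\<^sub>l x) \<cdot>\<^sub>r e)"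

lemma re_set_quat: "re_set = range (of_real :: real \<Rightarrow> quat)"
proof (intro set_eqI iffI)
  fix x :: quat
  assume "x \<in> re_set"
  then have "quat_i * x = x * quat_i" "quat_j * x = x * quat_j"
    by (auto simp: re_set_def lscale_quat_def rscale_quat_def)
  then have "x = of_real (qRe x)" by (simp add: quat_eq_iff)
  then show "x \<in> range of_real" by blast
qed (auto simp: re_set_def lscale_quat_def rscale_quat_def of_real_def)

text \<open>\<open>re_set\<close> as a real normed space in its own right, with the norm inherited from the ambient space.\<close>

typedef (overloaded) 'a re_part = "re_set :: 'a::quat_vector set"
  morphisms re_incl Abs_re_part
  by (rule exI[of _ 0]) (simp add: re_set_def)

setup_lifting type_definition_re_part

instantiation re_part :: (quat_normed_vector) real_normed_vector
begin

lift_definition norm_re_part :: "'a re_part \<Rightarrow> real" is norm .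

lift_definition zero_re_part :: "'a re_part" is 0 by (simp add: re_set_def)

lift_definition plus_re_part :: "'a re_part \<Rightarrow> 'a re_part \<Rightarrow> 'a re_part" is "(+)"
  by (simp add: re_set_def lscale_add_right rscale_add_left)

lift_definition uminus_re_part :: "'a re_part \<Rightarrow> 'a re_part" is uminus
  by (simp add: re_set_def)

lift_definition minus_re_part :: "'a re_part \<Rightarrow> 'a re_part \<Rightarrow> 'a re_part" is "(-)"
  by (simp add: re_set_def lscale_diff_right rscale_diff_left)

lift_definition scaleR_re_part :: "real \<Rightarrow> 'a re_part \<Rightarrow> 'a re_part" is scaleR
  by (simp add: re_set_def lscale_scaleR rscale_scaleR)

definition dist_re_part :: "'a re_part \<Rightarrow> 'a re_part \<Rightarrow> real"
  where "dist_re_part a b = norm (a - b)"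

definition [code del]:
  "(uniformity :: ('a re_part \<times> 'a re_part) filter) =
    (INF e\<in>{0<..}. principal {(x, y). dist x y < e})"

definition open_re_part :: "'a re_part set \<Rightarrow> bool"
  where [code del]: "open_re_part S = (\<forall>x\<in>S. \<forall>\<^sub>F (x', y) in uniformity. x' = x \<longrightarrow> y \<in> S)"

definition sgn_re_part :: "'a re_part \<Rightarrow> 'a re_part"
  where "sgn_re_part x = scaleR (inverse (norm x)) x"

instance
  apply standard
  unfolding dist_re_part_def open_re_part_def sgn_re_part_def uniformity_re_part_def
  by (rule refl | (transfer, simp add: norm_triangle_ineq algebra_simps))+

end

lemma bounded_linear_re_incl: "bounded_linear (re_incl :: 'a::quat_normed_vector re_part \<Rightarrow> 'a)"
  by (rule bounded_linear_intro[where K = 1])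
    (simp_all add: plus_re_part.rep_eq scaleR_re_part.rep_eq norm_re_part.rep_eq)

lemma norm_re_incl: "norm (re_incl x) = norm x"
  by (simp add: norm_re_part.rep_eq)


section \<open>Bounded bimodule maps\<close>

text \<open>
  An additive map commuting with the quaternionic actions is automatically real-linear, so the
  bounded bimodule maps can be carved out of the library's type of bounded real-linear maps,
  from which they inherit the operator norm.
\<close>

typedef (overloaded) ('a, 'b) quat_blinfun =
  "{T :: 'a::quat_normed_vector \<Rightarrow>\<^sub>L 'b::quat_normed_vector.
     (\<forall>\<alpha> x. T (\<alpha> \<cdot>\<^sub>l x) = \<alpha> \<cdot>\<^sub>l T x) \<and> (\<forall>x \<alpha>. T (x \<cdot>\<^sub>r \<alpha>) = T x \<cdot>\<^sub>r \<alpha>)}"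
  morphisms blinfun_of_quat Abs_quat_blinfun
  by (rule exI[of _ 0]) simp

setup_lifting type_definition_quat_blinfun

lift_definition quat_blinfun_apply ::
  "('a::quat_normed_vector, 'b::quat_normed_vector) quat_blinfun \<Rightarrow> 'a \<Rightarrow> 'b"
  is blinfun_apply .

declare [[coercion
  "quat_blinfun_apply ::
    ('a::quat_normed_vector, 'b::quat_normed_vector) quat_blinfun \<Rightarrow> 'a \<Rightarrow> 'b"]]

instantiation quat_blinfun :: (quat_normed_vector, quat_normed_vector) real_normed_vector
begin

lift_definition norm_quat_blinfun :: "('a, 'b) quat_blinfun \<Rightarrow> real" is norm .

lift_definition zero_quat_blinfun :: "('a, 'b) quat_blinfun" is 0 by simp

lift_definition plus_quat_blinfun ::
  "('a, 'b) quat_blinfun \<Rightarrow> ('a, 'b) quat_blinfun \<Rightarrow> ('a, 'b) quat_blinfun" is "(+)"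
  by (simp add: blinfun.add_left lscale_add_right rscale_add_left)

lift_definition uminus_quat_blinfun ::
  "('a, 'b) quat_blinfun \<Rightarrow> ('a, 'b) quat_blinfun" is uminus
  by (simp add: blinfun.minus_left)

lift_definition minus_quat_blinfun ::
  "('a, 'b) quat_blinfun \<Rightarrow> ('a, 'b) quat_blinfun \<Rightarrow> ('a, 'b) quat_blinfun" is "(-)"
  by (simp add: blinfun.diff_left lscale_diff_right rscale_diff_left)

lift_definition scaleR_quat_blinfun ::
  "real \<Rightarrow> ('a, 'b) quat_blinfun \<Rightarrow> ('a, 'b) quat_blinfun" is scaleR
  by (simp add: blinfun.scaleR_left lscale_scaleR rscale_scaleR)

definition dist_quat_blinfun :: "('a, 'b) quat_blinfun \<Rightarrow> ('a, 'b) quat_blinfun \<Rightarrow> real"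
  where "dist_quat_blinfun a b = norm (a - b)"

definition [code del]:
  "(uniformity :: (('a, 'b) quat_blinfun \<times> ('a, 'b) quat_blinfun) filter) =
    (INF e\<in>{0<..}. principal {(x, y). dist x y < e})"

definition open_quat_blinfun :: "('a, 'b) quat_blinfun set \<Rightarrow> bool"
  where [code del]: "open_quat_blinfun S =
    (\<forall>x\<in>S. \<forall>\<^sub>F (x', y) in uniformity. x' = x \<longrightarrow> y \<in> S)"

definition sgn_quat_blinfun :: "('a, 'b) quat_blinfun \<Rightarrow> ('a, 'b) quat_blinfun"
  where "sgn_quat_blinfun x = scaleR (inverse (norm x)) x"

instance
  apply standard
  unfolding dist_quat_blinfun_def open_quat_blinfun_def sgn_quat_blinfun_def
    uniformity_quat_blinfun_def
  by (rule refl | (transfer, simp add: norm_triangle_ineq algebra_simps))+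

end

lemma norm_quat_blinfun_onorm: "norm T = onorm (quat_blinfun_apply T)"
  by transfer (simp add: norm_blinfun.rep_eq)

class quat_banach = quat_normed_vector + banach

instance quat :: quat_banach ..

instance quat_blinfun :: (quat_normed_vector, quat_banach) banach
proof
  fix X :: "nat \<Rightarrow> ('a, 'b) quat_blinfun"
  assume X: "Cauchy X"
  have dist_eq: "dist (blinfun_of_quat S) (blinfun_of_quat T) = dist S T"
    for S T :: "('a, 'b) quat_blinfun"
    by (simp add: dist_norm norm_quat_blinfun.rep_eq minus_quat_blinfun.rep_eq)
  have "Cauchy (\<lambda>n. blinfun_of_quat (X n))"
    using X by (simp add: Cauchy_def dist_eq)
  then obtain L where L: "(\<lambda>n. blinfun_of_quat (X n)) \<longlonglongrightarrow> L"
    using Cauchy_convergent convergentD by blast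
  have lim: "(\<lambda>n. blinfun_of_quat (X n) x) \<longlonglongrightarrow> L x" for x
    using L by (intro blinfun.tendsto tendsto_const)
  have hom: "blinfun_of_quat (X n) (\<alpha> \<cdot>\<^sub>l x) = \<alpha> \<cdot>\<^sub>l blinfun_of_quat (X n) x"
    "blinfun_of_quat (X n) (x \<cdot>\<^sub>r \<alpha>) = blinfun_of_quat (X n) x \<cdot>\<^sub>r \<alpha>" for n \<alpha> x
    using blinfun_of_quat[of "X n"] by auto
  have "L (\<alpha> \<cdot>\<^sub>l x) = \<alpha> \<cdot>\<^sub>l L x" for \<alpha> x
    using lim[of "\<alpha> \<cdot>\<^sub>l x"] bounded_linear.tendsto[OF bounded_linear_lscale lim]
    unfolding hom by (rule LIMSEQ_unique)
  moreover have "L (x \<cdot>\<^sub>r \<alpha>) = L x \<cdot>\<^sub>r \<alpha>" for \<alpha> x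
    using lim[of "x \<cdot>\<^sub>r \<alpha>"] bounded_linear.tendsto[OF bounded_linear_rscale lim]
    unfolding hom by (rule LIMSEQ_unique)
  ultimately have "blinfun_of_quat (Abs_quat_blinfun L) = L"
    by (simp add: Abs_quat_blinfun_inverse)
  with L have "X \<longlonglongrightarrow> Abs_quat_blinfun L"
    by (metis (no_types, lifting) dist_eq lim_sequentially)
  then show "convergent X" by (rule convergentI)
qed

lemma quat_blinfun_re_set:
  fixes T :: "('a::quat_normed_vector, 'b::quat_normed_vector) quat_blinfun"
  assumes "x \<in> re_set"
  shows "T x \<in> re_set"
proof -
  have "T (\<alpha> \<cdot>\<^sub>l x) = \<alpha> \<cdot>\<^sub>l T x" "T (x \<cdot>\<^sub>r \<alpha>) = T x \<cdot>\<^sub>r \<alpha>" for \<alpha>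
    by (transfer, simp)+
  with assms show ?thesis by (simp add: re_set_def)
qed

text \<open>
  Restriction to the real part. The values on \<open>re_set\<close> are quaternions in the image of
  \<open>of_real\<close>; \<open>qRe\<close> merely performs the identification of that image with the type of reals.
\<close>

lift_definition restrict_re ::
  "('a::quat_normed_vector, quat) quat_blinfun \<Rightarrow> 'a re_part \<Rightarrow>\<^sub>L real"
  is "\<lambda>T x. qRe (blinfun_apply T (re_incl x))"
proof -
  fix T :: "'a \<Rightarrow>\<^sub>L quat"
  have "bounded_linear qRe"
  proof (rule bounded_linear_intro[where K = 1])
    show "norm (qRe x) \<le> norm x * 1" for x
      by (simp add: norm_quat_def real_le_rsqrt)
  qed simp_all
  then show "bounded_linear (\<lambda>x. qRe (T (re_incl x)))"
    by (intro bounded_linear_compose[OF _ bounded_linear_blinfun_apply] bounded_linear_re_incl)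
qed

lemma of_real_restrict_re: "of_real (restrict_re T x) = T (re_incl x)"
proof -
  have "restrict_re T x = qRe (T (re_incl x))"
    by transfer simp
  moreover have "T (re_incl x) \<in> range of_real"
    using quat_blinfun_re_set[OF re_incl[of x], of T] by (simp add: re_set_quat)
  ultimately show ?thesis by auto
qed

end

theory Submission
  imports Defs
begin

text \<open>
  Write \<open>Re\<close> for \<^const>\<open>re_proj\<close>. It is an average of four maps \<open>x \<mapsto> e\<^sup>* x e\<close>, each of norm at
  most 1, which gives the bound on its norm. Multiplication by \<open>i\<close> or \<open>j\<close> permutes the basis
  \<open>{1, i, j, k}\<close> up to signs, and \<open>e\<^sup>* x e\<close> does not change when \<open>e\<close> is replaced by \<open>-e\<close>. Two facts
  follow: \<open>Re\<close> takes its values in the real part (\<open>re_proj_in_re_set\<close>), and it is cyclic,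
  \<open>Re (\<alpha> x) = Re (x \<alpha>)\<close> (\<open>re_proj_cyclic\<close>).

  A bimodule map \<open>T\<close> into the quaternions intertwines \<open>Re\<close> with the real part \<open>qRe\<close> of a
  quaternion, so its restriction \<open>\<phi>\<close> to the real part of the space satisfies
  \<open>qRe (T x) = \<phi> (Re x)\<close> for every \<open>x\<close>. Multiplying \<open>T x\<close> by a suitable unit quaternion \<open>u\<close> turns
  it into its own norm, whence \<open>\<parallel>T x\<parallel> = qRe (T (u x)) = \<phi> (Re (u x)) \<le> \<parallel>\<phi>\<parallel> \<parallel>x\<parallel>\<close>. Restriction is
  thus isometric, and in particular injective.

  For surjectivity, given \<open>\<phi>\<close> put \<open>g x = \<phi> (Re x)\<close>. The pairing \<open>(\<beta>, q) \<mapsto> qRe (\<beta> q)\<close> on the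
  quaternions is nondegenerate, so there is exactly one quaternion \<open>T x\<close> with
  \<open>qRe (\<beta> T x) = g (\<beta> x)\<close> for all \<open>\<beta>\<close>. Uniqueness turns associativity of the left action into left
  linearity of \<open>T\<close>, and cyclicity of \<open>g\<close> into right linearity.
\<close>

section \<open>Quaternions\<close>

text \<open>
  The reals together with \<open>i\<close> and \<open>j\<close> generate the quaternions as a ring. Statements about
  a quaternion acting on a bimodule that are stable under sums and products, and clear for real
  scalars, need therefore be checked for \<open>i\<close> and \<open>j\<close> only.
\<close>

lemma quat_ring_induct [case_names of_real i j add mult]:
  assumes "\<And>r. P (of_real r)" "P quat_i" "P quat_j"
    and add: "\<And>\<alpha> \<beta>. P \<alpha> \<Longrightarrow> P \<beta> \<Longrightarrow> P (\<alpha> + \<beta>)"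
    and mult: "\<And>\<alpha> \<beta>. P \<alpha> \<Longrightarrow> P \<beta> \<Longrightarrow> P (\<alpha> * \<beta>)"
  shows "P \<alpha>"
proof -
  have "\<alpha> = of_real (qRe \<alpha>) + of_real (qI \<alpha>) * quat_i + of_real (qJ \<alpha>) * quat_j
      + of_real (qK \<alpha>) * (quat_i * quat_j)"
    by (simp add: quat_eq_iff)
  moreover have "P \<dots>"
    by (intro add mult assms)
  ultimately show ?thesis by simp
qed

text \<open>The trace form \<open>(\<beta>, q) \<mapsto> qRe (\<beta> q)\<close> is nondegenerate, since \<open>qRe (\<beta>\<^sup>* q)\<close> is the inner product.\<close>

lemma quat_eqI_trace:
  assumes "\<And>\<beta>. qRe (\<beta> * p) = qRe (\<beta> * q)"
  shows "p = q"
  using assms[of 1] assms[of quat_i] assms[of quat_j] assms[of quat_k]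
  by (simp add: quat_eq_iff)

lemma qRe_mult_commute: "qRe (\<alpha> * \<beta>) = qRe (\<beta> * \<alpha>)"
  by simp

lemma norm_quat_units [simp]: "norm quat_i = 1" "norm quat_j = 1" "norm quat_k = 1"
  by (simp_all add: norm_quat_def)

lemma norm_qcnj [simp]: "norm (qcnj q) = norm q"
  by (simp add: norm_quat_def)

lemma qcnj_units: "qcnj 1 = 1" "qcnj quat_i = - quat_i" "qcnj quat_j = - quat_j" "qcnj quat_k = - quat_k"
  by (simp_all add: quat_eq_iff)

lemma abs_qRe_le_norm: "\<bar>qRe q\<bar> \<le> norm q"
  by (simp add: norm_quat_def real_le_rsqrt)

text \<open>Every quaternion is rotated onto its norm by a unit quaternion, namely \<open>q\<^sup>* / \<parallel>q\<parallel>\<close>.\<close>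

lemma quat_rotate_to_norm: "\<exists>u. norm u = 1 \<and> qRe (u * q) = norm q"
proof (cases "q = 0")
  case True
  then show ?thesis by (intro exI[of _ 1]) simp
next
  case False
  have "qRe (qcnj q * q) = (norm q)\<^sup>2"
    by (simp add: norm_quat_def power2_eq_square[symmetric])
  with False show ?thesis
    by (intro exI[of _ "(1 / norm q) *\<^sub>R qcnj q"]) (simp add: power2_eq_square field_simps)
qed


section \<open>The projection onto the real part\<close>

lemma lscale_minus_left: "(- \<alpha>) \<cdot>\<^sub>l (x::'a::quat_vector) = - (\<alpha> \<cdot>\<^sub>l x)"
  using lscale_of_real[of "-1" "\<alpha> \<cdot>\<^sub>l x"] by (simp add: lscale_lscale)

lemma rscale_minus_right: "(x::'a::quat_vector) \<cdot>\<^sub>r (- \<alpha>) = - (x \<cdot>\<^sub>r \<alpha>)"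
  using rscale_of_real[of "x \<cdot>\<^sub>r \<alpha>" "-1"] by (simp add: rscale_rscale)

lemmas quat_bimodule_simps =
  lscale_add_right rscale_add_left lscale_diff_right rscale_diff_left
  lscale_scaleR rscale_scaleR lscale_lscale rscale_rscale lscale_rscale
  lscale_minus_left rscale_minus_right lscale_one rscale_one

lemma re_proj_expand:
  "re_proj x = (1/4) *\<^sub>R (x - quat_i \<cdot>\<^sub>l (x \<cdot>\<^sub>r quat_i) - quat_j \<cdot>\<^sub>l (x \<cdot>\<^sub>r quat_j)
    - quat_k \<cdot>\<^sub>l (x \<cdot>\<^sub>r quat_k))"
  using quat_units_distinct
  by (simp add: re_proj_def qcnj_units quat_bimodule_simps)

lemma linear_re_proj: "linear (re_proj :: 'a::quat_vector \<Rightarrow> 'a)"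
  by (rule linearI) (simp_all add: re_proj_expand quat_bimodule_simps algebra_simps)

lemma norm_re_proj_le: "norm (re_proj x) \<le> norm (x::'a::quat_normed_vector)"
proof -
  have "norm ((qcnj e \<cdot>\<^sub>l x) \<cdot>\<^sub>r e) \<le> norm x" if "e \<in> {1, quat_i, quat_j, quat_k}" for e
    using norm_lscale_rscale[of "qcnj e" x e] that by auto
  then have "norm (\<Sum>e\<in>{1, quat_i, quat_j, quat_k}. (qcnj e \<cdot>\<^sub>l x) \<cdot>\<^sub>r e)
      \<le> of_nat (card {1, quat_i, quat_j, quat_k}) * norm x"
    by (rule sum_norm_bound)
  also have "card {1, quat_i, quat_j, quat_k} = 4"
    using quat_units_distinct by simp
  finally show ?thesis
    by (simp add: re_proj_def)
qed

lemma bounded_linear_re_proj: "bounded_linear (re_proj :: 'a::quat_normed_vector \<Rightarrow> 'a)"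
  by (rule bounded_linear_intro[where K = 1])
    (simp_all add: linear_add[OF linear_re_proj] linear_scale[OF linear_re_proj] norm_re_proj_le)

text \<open>
  If \<open>u\<close> is a unit of the basis, then \<open>u e\<^sup>* x e = f\<^sup>* x f u\<close> for \<open>f = e u\<^sup>*\<close>, and \<open>f\<close> runs over
  the basis, up to signs, when \<open>e\<close> does.
\<close>

lemma re_proj_in_re_set: "re_proj x \<in> (re_set :: 'a::quat_vector set)"
proof -
  have "\<alpha> \<cdot>\<^sub>l re_proj x = re_proj x \<cdot>\<^sub>r \<alpha>" for \<alpha>
  proof (induction \<alpha> rule: quat_ring_induct)
    case (of_real r)
    show ?case by (simp only: lscale_of_real rscale_of_real)
  next
    case (add \<alpha> \<beta>)
    then show ?case by (simp only: lscale_add_left rscale_add_right)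
  next
    case (mult \<alpha> \<beta>)
    then show ?case
      by (simp only: lscale_lscale[symmetric] rscale_rscale[symmetric] lscale_rscale[symmetric])
  qed (simp_all add: re_proj_expand quat_bimodule_simps quat_unit_mult algebra_simps)
  then show ?thesis by (simp add: re_set_def)
qed

text \<open>For a unit \<open>u\<close> of the basis, \<open>e\<^sup>* u x e = f\<^sup>* x u f\<close> with \<open>f = u\<^sup>* e\<close>, which again only permutes
  the four summands.\<close>

lemma re_proj_cyclic: "re_proj (\<alpha> \<cdot>\<^sub>l x) = re_proj ((x::'a::quat_vector) \<cdot>\<^sub>r \<alpha>)"
proof (induction \<alpha> arbitrary: x rule: quat_ring_induct)
  case (of_real r)
  show ?case by (simp only: lscale_of_real rscale_of_real)
next
  case (add \<alpha> \<beta>)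
  then show ?case
    by (simp add: lscale_add_left rscale_add_right linear_add[OF linear_re_proj])
next
  case (mult \<alpha> \<beta>)
  have "re_proj ((\<alpha> * \<beta>) \<cdot>\<^sub>l x) = re_proj (\<alpha> \<cdot>\<^sub>l (\<beta> \<cdot>\<^sub>l x))"
    by (simp add: lscale_lscale)
  also have "\<dots> = re_proj (\<beta> \<cdot>\<^sub>l (x \<cdot>\<^sub>r \<alpha>))"
    using mult(1) by (simp add: lscale_rscale)
  also have "\<dots> = re_proj (x \<cdot>\<^sub>r (\<alpha> * \<beta>))"
    using mult(2) by (simp add: rscale_rscale)
  finally show ?case .
qed (simp_all add: re_proj_expand quat_bimodule_simps quat_unit_mult algebra_simps)

lemma re_proj_id_on_re_set:
  assumes "x \<in> re_set"
  shows "re_proj x = (x::'a::quat_vector)"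
proof -
  have "x \<cdot>\<^sub>r \<alpha> = \<alpha> \<cdot>\<^sub>l x" for \<alpha>
    using assms by (simp add: re_set_def)
  moreover have "(1/4) *\<^sub>R (x + x + x + x) = x"
    by (simp add: scaleR_right_distrib flip: scaleR_left_distrib)
  ultimately show ?thesis
    by (simp add: re_proj_expand quat_bimodule_simps quat_unit_mult)
qed

lemma re_proj_quat: "re_proj q = of_real (qRe q)"
  by (simp add: re_proj_expand lscale_quat_def rscale_quat_def quat_eq_iff)

lift_definition re_part_proj :: "'a::quat_vector \<Rightarrow> 'a re_part" is re_proj
  by (rule re_proj_in_re_set)

lemma re_part_proj_re_incl [simp]: "re_part_proj (re_incl y) = y"
  by transfer (rule re_proj_id_on_re_set)

lemma re_part_proj_cyclic: "re_part_proj (\<alpha> \<cdot>\<^sub>l x) = re_part_proj (x \<cdot>\<^sub>r \<alpha>)"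
  by transfer (rule re_proj_cyclic)

lemma norm_re_part_proj_le: "norm (re_part_proj x) \<le> norm (x::'a::quat_normed_vector)"
  by transfer (rule norm_re_proj_le)

lemma bounded_linear_re_part_proj:
  "bounded_linear (re_part_proj :: 'a::quat_normed_vector \<Rightarrow> 'a re_part)"
proof (rule bounded_linear_intro[where K = 1])
  show "re_part_proj (x + y) = re_part_proj x + re_part_proj y" for x y :: 'a
    by transfer (rule linear_add[OF linear_re_proj])
  show "re_part_proj (r *\<^sub>R x) = r *\<^sub>R re_part_proj x" for r and x :: 'a
    by transfer (rule linear_scale[OF linear_re_proj])
qed (simp add: norm_re_part_proj_le)


section \<open>Restriction of bimodule maps is isometric\<close>

lemma quat_blinfun_lscale: "quat_blinfun_apply T (\<alpha> \<cdot>\<^sub>l x) = \<alpha> \<cdot>\<^sub>l T x"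
  and quat_blinfun_rscale: "quat_blinfun_apply T (x \<cdot>\<^sub>r \<alpha>) = T x \<cdot>\<^sub>r \<alpha>"
  by (transfer, simp)+

lemma bounded_linear_quat_blinfun: "bounded_linear (quat_blinfun_apply T)"
  by transfer (rule blinfun.bounded_linear_right)

lemma restrict_re_apply:
  fixes T :: "('a::quat_normed_vector, quat) quat_blinfun"
  shows "restrict_re T y = qRe (T (re_incl y))"
  by transfer simp

lemma quat_blinfun_re_proj:
  fixes T :: "('a::quat_normed_vector, quat) quat_blinfun"
  shows "quat_blinfun_apply T (re_proj x) = re_proj (T x)"
proof -
  interpret bounded_linear "quat_blinfun_apply T" by (rule bounded_linear_quat_blinfun)
  show ?thesis
    by (simp add: re_proj_expand scaleR diff quat_blinfun_lscale quat_blinfun_rscale)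
qed

lemma qRe_quat_blinfun:
  fixes T :: "('a::quat_normed_vector, quat) quat_blinfun"
  shows "qRe (T x) = restrict_re T (re_part_proj x)"
  by (simp add: restrict_re_apply re_part_proj.rep_eq quat_blinfun_re_proj re_proj_quat)

lemma linear_restrict_re:
  "linear (restrict_re :: ('a::quat_normed_vector, quat) quat_blinfun \<Rightarrow> _)"
  by (rule linearI; rule blinfun_eqI)
    (simp_all add: restrict_re_apply blinfun.add_left blinfun.scaleR_left
      quat_blinfun_apply.rep_eq plus_quat_blinfun.rep_eq scaleR_quat_blinfun.rep_eq)

lemma norm_restrict_re:
  fixes T :: "('a::quat_normed_vector, quat) quat_blinfun"
  shows "norm (restrict_re T) = norm T"
proof (rule antisym)
  show "norm (restrict_re T) \<le> norm T"
  proof (rule norm_blinfun_bound)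
    fix y
    have "norm (restrict_re T y) \<le> norm (T (re_incl y))"
      by (simp add: restrict_re_apply abs_qRe_le_norm)
    also have "\<dots> \<le> norm T * norm y"
      using onorm[OF bounded_linear_quat_blinfun, of T "re_incl y"]
      by (simp only: norm_quat_blinfun_onorm norm_re_incl)
    finally show "norm (restrict_re T y) \<le> norm T * norm y" .
  qed simp
next
  have "norm (T x) \<le> norm (restrict_re T) * norm x" for x
  proof -
    obtain u where u: "norm u = 1" "qRe (u * T x) = norm (T x)"
      using quat_rotate_to_norm by blast
    have "norm (T x) = restrict_re T (re_part_proj (u \<cdot>\<^sub>l x))"
      using u(2) by (simp add: qRe_quat_blinfun[symmetric] quat_blinfun_lscale lscale_quat_def)
    also have "\<dots> \<le> norm (restrict_re T) * norm (re_part_proj (u \<cdot>\<^sub>l x))"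
      using norm_blinfun[of "restrict_re T" "re_part_proj (u \<cdot>\<^sub>l x)"] by simp
    also have "\<dots> \<le> norm (restrict_re T) * norm x"
      using norm_re_part_proj_le[of "u \<cdot>\<^sub>l x"] norm_lscale_le[of u x] u(1)
      by (intro mult_left_mono) auto
    finally show ?thesis .
  qed
  then show "norm T \<le> norm (restrict_re T)"
    unfolding norm_quat_blinfun_onorm by (intro onorm_bound) simp_all
qed


section \<open>Every real functional extends to a bimodule map\<close>

text \<open>
  For real-linear \<open>g\<close>, the condition \<open>qRe (\<beta> q) = g (\<beta> x)\<close> for all \<open>\<beta>\<close> determines the coordinates of \<open>q\<close>: take for \<open>\<beta>\<close>
  the conjugates of the basis elements.
\<close>

definition trace_extension :: "('a::quat_vector \<Rightarrow> real) \<Rightarrow> 'a \<Rightarrow> quat" where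
  "trace_extension g x =
    Quat (g x) (- g (quat_i \<cdot>\<^sub>l x)) (- g (quat_j \<cdot>\<^sub>l x)) (- g (quat_k \<cdot>\<^sub>l x))"

lemma trace_extension_char:
  assumes "linear g"
  shows "qRe (\<beta> * trace_extension g x) = g (\<beta> \<cdot>\<^sub>l x)"
proof -
  have "\<beta> = of_real (qRe \<beta>) + of_real (qI \<beta>) * quat_i + of_real (qJ \<beta>) * quat_j
      + of_real (qK \<beta>) * quat_k"
    by (simp add: quat_eq_iff)
  from arg_cong[OF this, where f = "\<lambda>\<beta>. \<beta> \<cdot>\<^sub>l x"]
  have "\<beta> \<cdot>\<^sub>l x = qRe \<beta> *\<^sub>R x + qI \<beta> *\<^sub>R (quat_i \<cdot>\<^sub>l x) + qJ \<beta> *\<^sub>R (quat_j \<cdot>\<^sub>l x)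
      + qK \<beta> *\<^sub>R (quat_k \<cdot>\<^sub>l x)"
    by (simp only: lscale_add_left lscale_lscale[symmetric] lscale_of_real)
  then show ?thesis
    by (simp add: trace_extension_def linear_add[OF assms] linear_scale[OF assms])
qed

lemma trace_extension_lscale:
  assumes "linear g"
  shows "trace_extension g (\<alpha> \<cdot>\<^sub>l x) = \<alpha> * trace_extension g x"
proof (rule quat_eqI_trace)
  fix \<beta>
  have "qRe (\<beta> * trace_extension g (\<alpha> \<cdot>\<^sub>l x)) = g ((\<beta> * \<alpha>) \<cdot>\<^sub>l x)"
    by (simp only: trace_extension_char[OF assms] lscale_lscale)
  also have "\<dots> = qRe (\<beta> * (\<alpha> * trace_extension g x))"
    by (simp only: trace_extension_char[OF assms, symmetric] mult.assoc)
  finally show "qRe (\<beta> * trace_extension g (\<alpha> \<cdot>\<^sub>l x)) = qRe (\<beta> * (\<alpha> * trace_extension g x))" .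
qed

lemma trace_extension_rscale:
  assumes g: "linear g" and cyclic: "\<And>\<alpha> x. g (\<alpha> \<cdot>\<^sub>l x) = g (x \<cdot>\<^sub>r \<alpha>)"
  shows "trace_extension g (x \<cdot>\<^sub>r \<alpha>) = trace_extension g x * \<alpha>"
proof (rule quat_eqI_trace)
  fix \<beta>
  have "qRe (\<beta> * trace_extension g (x \<cdot>\<^sub>r \<alpha>)) = g ((\<beta> \<cdot>\<^sub>l x) \<cdot>\<^sub>r \<alpha>)"
    by (simp only: trace_extension_char[OF g] lscale_rscale)
  also have "\<dots> = g ((\<alpha> * \<beta>) \<cdot>\<^sub>l x)"
    by (simp only: cyclic[symmetric] lscale_lscale)
  also have "\<dots> = qRe (\<alpha> * (\<beta> * trace_extension g x))"
    by (simp only: trace_extension_char[OF g, symmetric] mult.assoc)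
  also have "\<dots> = qRe (\<beta> * (trace_extension g x * \<alpha>))"
    by (simp only: qRe_mult_commute[of \<alpha>] mult.assoc)
  finally show "qRe (\<beta> * trace_extension g (x \<cdot>\<^sub>r \<alpha>)) = qRe (\<beta> * (trace_extension g x * \<alpha>))" .
qed

lemma bounded_linear_trace_extension:
  fixes g :: "'a::quat_normed_vector \<Rightarrow> real"
  assumes "bounded_linear g"
  shows "bounded_linear (trace_extension g)"
proof -
  have "bounded_linear (\<lambda>x. g x *\<^sub>R 1 - g (quat_i \<cdot>\<^sub>l x) *\<^sub>R quat_i - g (quat_j \<cdot>\<^sub>l x) *\<^sub>R quat_j
      - g (quat_k \<cdot>\<^sub>l x) *\<^sub>R quat_k)"
    by (intro bounded_linear_sub bounded_linear_compose[OF bounded_linear_scaleR_left]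
        bounded_linear_compose[OF assms] assms bounded_linear_lscale)
  moreover have "g x *\<^sub>R 1 - g (quat_i \<cdot>\<^sub>l x) *\<^sub>R quat_i - g (quat_j \<cdot>\<^sub>l x) *\<^sub>R quat_j
      - g (quat_k \<cdot>\<^sub>l x) *\<^sub>R quat_k = trace_extension g x" for x
    by (simp add: quat_eq_iff trace_extension_def)
  ultimately show ?thesis by simp
qed

lemma surj_restrict_re:
  "surj (restrict_re :: ('a::quat_normed_vector, quat) quat_blinfun \<Rightarrow> _)"
proof (rule surjI)
  fix \<phi> :: "'a re_part \<Rightarrow>\<^sub>L real"
  define g where "g = (\<lambda>x. \<phi> (re_part_proj x))"
  have g: "bounded_linear g"
    unfolding g_def
    by (rule bounded_linear_compose[OF blinfun.bounded_linear_right bounded_linear_re_part_proj])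
  then have lin: "linear g"
    by (rule bounded_linear.linear)
  have cyclic: "g (\<alpha> \<cdot>\<^sub>l x) = g (x \<cdot>\<^sub>r \<alpha>)" for \<alpha> x
    by (simp add: g_def re_part_proj_cyclic)
  let ?T = "Abs_quat_blinfun (Blinfun (trace_extension g))"
  have "quat_blinfun_apply ?T = trace_extension g"
    by (simp add: quat_blinfun_apply.rep_eq Abs_quat_blinfun_inverse
        bounded_linear_Blinfun_apply[OF bounded_linear_trace_extension[OF g]]
        trace_extension_lscale[OF lin] trace_extension_rscale[OF lin cyclic]
        lscale_quat_def rscale_quat_def)
  then show "restrict_re (Abs_quat_blinfun (Blinfun (trace_extension (\<lambda>x. \<phi> (re_part_proj x))))) = \<phi>"
    unfolding g_def[symmetric]
    by (intro blinfun_eqI) (simp add: restrict_re_apply trace_extension_def g_def)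
qed


section \<open>The isometric isomorphism\<close>

theorem lemma2p3:
  shows
    "(bounded_linear (re_proj :: 'a::quat_normed_vector \<Rightarrow> 'a) \<and>
      onorm (re_proj :: 'a \<Rightarrow> 'a) \<le> 1) \<and>
     (linear (restrict_re :: ('a, quat) quat_blinfun \<Rightarrow> ('a re_part \<Rightarrow>\<^sub>L real)) \<and>
      bij (restrict_re :: ('a, quat) quat_blinfun \<Rightarrow> ('a re_part \<Rightarrow>\<^sub>L real)) \<and>
      (\<forall>T :: ('a, quat) quat_blinfun. norm (restrict_re T) = norm T))"
proof -
  have "onorm (re_proj :: 'a \<Rightarrow> 'a) \<le> 1"
    by (rule onorm_bound) (simp_all add: norm_re_proj_le)
  moreover have "inj (restrict_re :: ('a, quat) quat_blinfun \<Rightarrow> _)"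
    unfolding linear_injective_0[OF linear_restrict_re] by (metis norm_restrict_re norm_eq_zero)
  ultimately show ?thesis
    using bounded_linear_re_proj linear_restrict_re surj_restrict_re norm_restrict_re
    by (auto simp: bij_def)
qed

end
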